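(* Let $\mathcal{X}$ and $\mathcal{Y}$ be non-empty finite sets, $1/2 < \alpha < 1$, $\epsilon > 0$, $0 < \delta < 1$, let $p$ be a probability mass function on $\mathcal{X}$, $w$ a transition function from $\mathcal{X}$ to $\mathcal{Y}$, and $S$ a training set of $n$ i.i.d. pairs with distribution $p\times w$, where the positive integer $n$ satisfies $$n \ge \left(\frac{|\mathcal{X}||\mathcal{Y}|}{\epsilon \ln 2}\right)^{1/(1-\alpha)} \quad\text{and}\quad n \ge \left(\frac{1}{2}\ln\left(\frac{|\mathcal{X}||\mathcal{Y}|}{\delta}\right)\right)^{1/(2\alpha-1)} .$$ If the $\alpha$-virtual sample algorithm returns the decoding metric $K$ for the input $S$, then $$\Pr[\, I(p,w) - \epsilon < I_{\mathrm{LM}}(p,w,K)\,] > 1-\delta .$$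
   Context: A transition function $w$ from $\mathcal{X}$ to $\mathcal{Y}$ assigns to each $x \in \mathcal{X}$ a probability mass function (PMF) $w(\cdot|x)$ on $\mathcal{Y}$. For a PMF $p$ on $\mathcal{X}$, $pw$ is the PMF on $\mathcal{Y}$ given by $pw(y) = \sum_{x} p(x) w(y|x)$; $p \times w$ is the PMF on $\mathcal{X}\times\mathcal{Y}$ given by $(p\times w)(x,y) = p(x)w(y|x)$; $I(p,w)$ is the mutual information, in bits, between $X$ and $Y$ when $(X,Y)\sim p\times w$. A decoding metric is a function $k : \mathcal{X}\times\mathcal{Y}\to[0,\infty)$. The LM rate is $$I_{\mathrm{LM}}(p,w,k) = \min_{\tilde w \in \tilde W(p,w)} I(p,\tilde w),$$ where $\tilde W(p,w)$ is the set of transition functions $\tilde w$ from $\mathcal{X}$ to $\mathcal{Y}$ with $p\tilde w = pw$ and $$E_{(X,Y)\sim p\times\tilde w}\log_2 k(X,Y) \ge E_{(X,Y)\sim p\times w}\log_2 k(X,Y),$$ with the conventions $\log_2 0 = -\infty$ and $0\cdot(-\infty)=0$. A training set of size $n$ is a sequence $s\in(\mathcal{X}\times\mathcal{Y})^n$; $N(x,y|s)$ denotes the number of occurrences of the pair $(x,y)$ in $s$. For $\alpha\in\mathbb{R}$, the $\alpha$-virtual sample algorithm is the mapping that, for every positive integer $n$ and every $s\in(\mathcal{X}\times\mathcal{Y})^n$, returns the decoding metric $k$ given by $k(x,y) = N(x,y|s) + n^{\alpha}$ for all $x\in\mathcal{X}$, $y\in\mathcal{Y}$. *)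

theory Defs
  imports "HOL-Probability.Probability" "HOL-Real_Asymp.Real_Asymp"
begin

text \<open>
  Alphabets are finite types (hence non-empty); a transition function is a map of type
  \<open>'x \<Rightarrow> 'y pmf\<close>. The output distribution \<open>pw\<close> is \<^term>\<open>bind_pmf p w\<close>.
\<close>

definition joint_pmf :: "'x pmf \<Rightarrow> ('x \<Rightarrow> 'y pmf) \<Rightarrow> ('x \<times> 'y) pmf" where
  "joint_pmf p w = bind_pmf p (\<lambda>x. map_pmf (Pair x) (w x))"

lemma pmf_joint_pmf: "pmf (joint_pmf p w) (x, y) = pmf p x * pmf (w x) y"
proof -
  have "pmf (map_pmf (Pair x') (w x')) (x, y) = indicator {x} x' * pmf (w x) y" for x'
  proof (cases "x' = x")
    case True
    then show ?thesis
      by (simp add: pmf_map_inj' inj_on_def)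
  next
    case False
    then have "(x, y) \<notin> set_pmf (map_pmf (Pair x') (w x'))"
      by auto
    then have "pmf (map_pmf (Pair x') (w x')) (x, y) = 0"
      by (simp only: set_pmf_iff not_not)
    with False show ?thesis
      by simp
  qed
  then show ?thesis
    by (simp add: joint_pmf_def pmf_bind measure_pmf_single)
qed

lemma pmf_output:
  fixes p :: "'x::finite pmf"
  shows "pmf (bind_pmf p w) y = (\<Sum>x\<in>UNIV. pmf p x * pmf (w x) y)"
  by (simp add: pmf_bind integral_measure_pmf_real[where A=UNIV] mult.commute)

definition mutual_info :: "'x pmf \<Rightarrow> ('x \<Rightarrow> 'y pmf) \<Rightarrow> real" where
  "mutual_info p w =
     prob_space.mutual_information (measure_pmf (joint_pmf p w)) 2
       (count_space UNIV) (count_space UNIV) fst snd"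

lemma mutual_info_eq:
  fixes p :: "'x::finite pmf" and w :: "'x \<Rightarrow> 'y::finite pmf"
  shows "mutual_info p w =
    (\<Sum>(x,y)\<in>UNIV. pmf p x * pmf (w x) y * log 2 (pmf (w x) y / pmf (bind_pmf p w) y))"
proof -
  let ?J = "joint_pmf p w"
  interpret information_space "measure_pmf ?J" 2 by unfold_locales auto
  have m1: "map_pmf fst ?J = p" by (simp add: joint_pmf_def map_bind_pmf map_pmf_comp bind_return_pmf' )
  have m2: "map_pmf snd ?J = bind_pmf p w" by (simp add: joint_pmf_def map_bind_pmf map_pmf_comp)
  have D: "distributed (measure_pmf ?J) (count_space UNIV) X (pmf (map_pmf X ?J))" for X :: "'x \<times> 'y \<Rightarrow> 'z"
    unfolding distributed_def by (auto simp: measure_pmf_eq_density[symmetric] map_pmf_rep_eq[symmetric])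
  have "mutual_info p w = integral\<^sup>L (count_space UNIV \<Otimes>\<^sub>M count_space UNIV)
      (\<lambda>z. pmf ?J z * log 2 (pmf ?J z / (pmf p (fst z) * pmf (bind_pmf p w) (snd z))))"
    unfolding mutual_info_def
  proof (rule mutual_information_distr)
    show "distributed (measure_pmf ?J) (count_space UNIV) fst (pmf p)"
      using D[of fst] by (simp add: m1)
    show "distributed (measure_pmf ?J) (count_space UNIV) snd (pmf (bind_pmf p w))"
      using D[of snd] by (simp add: m2)
    show "distributed (measure_pmf ?J) (count_space UNIV \<Otimes>\<^sub>M count_space UNIV) (\<lambda>x. (fst x, snd x)) (pmf ?J)"
      using D[of "\<lambda>x. x"] by (simp add: pair_measure_countable)
  qed (auto simp: sigma_finite_measure_count_space_finite)
  also have "\<dots> = (\<Sum>z\<in>UNIV. pmf ?J z * log 2 (pmf ?J z / (pmf p (fst z) * pmf (bind_pmf p w) (snd z))))"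
    by (simp add: pair_measure_countable lebesgue_integral_count_space_finite)
  also have "\<dots> = (\<Sum>(x,y)\<in>UNIV. pmf p x * pmf (w x) y * log 2 (pmf (w x) y / pmf (bind_pmf p w) y))"
    by (intro sum.cong) (auto simp: pmf_joint_pmf)
  finally show ?thesis .
qed

text \<open>
  Decoding metrics have type \<open>'x \<Rightarrow> 'y \<Rightarrow> real\<close> and are meant to be
  non-negative. Since \<open>0 * (-\<infinity>) = 0\<close> in \<^typ>\<open>ereal\<close> and \<open>elog2\<close> never
  takes the value \<open>\<infinity>\<close>, the sum below realises the required conventions.
\<close>

definition elog2 :: "real \<Rightarrow> ereal" where
  "elog2 t = (if t = 0 then -\<infinity> else ereal (log 2 t))"

definition expected_log_metric ::
    "('x::finite \<times> 'y::finite) pmf \<Rightarrow> ('x \<Rightarrow> 'y \<Rightarrow> real) \<Rightarrow> ereal" where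
  "expected_log_metric q k = (\<Sum>(x, y)\<in>UNIV. ereal (pmf q (x, y)) * elog2 (k x y))"

lemma expected_log_metric_eq:
  fixes p :: "'x::finite pmf" and v :: "'x \<Rightarrow> 'y::finite pmf"
  shows "expected_log_metric (joint_pmf p v) k =
    (if \<exists>x y. k x y = 0 \<and> pmf p x * pmf (v x) y \<noteq> 0 then -\<infinity>
     else ereal (\<Sum>(x,y)\<in>UNIV. pmf p x * pmf (v x) y * log 2 (k x y)))"
proof (cases "\<exists>x y. k x y = 0 \<and> pmf p x * pmf (v x) y \<noteq> 0")
  case True
  let ?f = "\<lambda>(x,y). ereal (pmf p x * pmf (v x) y) * elog2 (k x y)"
  have np: "?f z \<noteq> \<infinity>" for z
  proof -
    obtain x y where z: "z = (x, y)" by force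
    have "\<not> pmf p x * pmf (v x) y < 0" by (simp add: not_less)
    then show ?thesis by (auto simp: z elog2_def)
  qed
  from True obtain x y where xy: "k x y = 0" "pmf p x * pmf (v x) y \<noteq> 0" by blast
  then have "pmf p x * pmf (v x) y > 0"
    by (metis less_eq_real_def mult_nonneg_nonneg pmf_nonneg)
  then have mi: "?f (x, y) = -\<infinity>" using xy by (simp add: elog2_def)
  have "sum ?f UNIV = ?f (x,y) + sum ?f (UNIV - {(x,y)})"
    by (rule sum.remove) auto
  also have "\<dots> = -\<infinity>"
  proof -
    have "sum ?f (UNIV - {(x,y)}) \<noteq> \<infinity>"
      using np by (simp only: sum_Pinfty) blast
    then show ?thesis by (simp only: mi) (cases "sum ?f (UNIV - {(x,y)})", auto)
  qed
  finally show ?thesis using True by (simp add: expected_log_metric_def pmf_joint_pmf)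
next
  case False
  have "expected_log_metric (joint_pmf p v) k = (\<Sum>(x,y)\<in>UNIV. ereal (pmf p x * pmf (v x) y * log 2 (k x y)))"
    unfolding expected_log_metric_def using False
    by (intro sum.cong) (auto simp: pmf_joint_pmf elog2_def)
  also have "\<dots> = ereal (\<Sum>(x,y)\<in>UNIV. pmf p x * pmf (v x) y * log 2 (k x y))"
    by (simp add: case_prod_beta)
  finally show ?thesis using False by simp
qed

definition LM_constraint ::
    "'x::finite pmf \<Rightarrow> ('x \<Rightarrow> 'y::finite pmf) \<Rightarrow> ('x \<Rightarrow> 'y \<Rightarrow> real) \<Rightarrow> ('x \<Rightarrow> 'y pmf) set" where
  "LM_constraint p w k =
     {v. bind_pmf p v = bind_pmf p w \<and>
         expected_log_metric (joint_pmf p v) k \<ge> expected_log_metric (joint_pmf p w) k}"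

text \<open>
  The minimum is written as an infimum; \<open>LM_rate_attained\<close> below shows that it is attained.
\<close>

definition LM_rate ::
    "'x::finite pmf \<Rightarrow> ('x \<Rightarrow> 'y::finite pmf) \<Rightarrow> ('x \<Rightarrow> 'y \<Rightarrow> real) \<Rightarrow> real" where
  "LM_rate p w k = (INF v\<in>LM_constraint p w k. mutual_info p v)"

lemma continuous_on_mult_log2: "continuous_on {0..} (\<lambda>t::real. t * log 2 (t / c))"
  if c: "c \<ge> 0"
proof (cases "c = 0")
  case False
  with c have "c > 0" by simp
  have "((\<lambda>t. t * log 2 (t / c)) \<longlongrightarrow> 0) (at_right 0)"
    using \<open>c > 0\<close> by real_asymp
  show ?thesis
    unfolding continuous_on_eq_continuous_within
  proof
    fix x :: real assume "x \<in> {0..}"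
    show "continuous (at x within {0..}) (\<lambda>t. t * log 2 (t / c))"
    proof (cases "x = 0")
      case True
      have "at 0 within {0..} = at_right (0::real)"
        by (simp add: at_within_Ici_at_right)
      with \<open>((\<lambda>t. t * log 2 (t / c)) \<longlongrightarrow> 0) (at_right 0)\<close> True show ?thesis
        by (simp add: continuous_within)
    next
      case False
      with \<open>x \<in> {0..}\<close> have "x > 0" by simp
      then show ?thesis using \<open>c > 0\<close> by (intro continuous_intros) auto
    qed
  qed
qed (auto intro!: continuous_intros)

lemma LM_rate_attained:
  fixes p :: "'x::finite pmf" and w :: "'x \<Rightarrow> 'y::finite pmf"
  obtains v where "v \<in> LM_constraint p w k" "LM_rate p w k = mutual_info p v"
    "\<And>u. u \<in> LM_constraint p w k \<Longrightarrow> mutual_info p v \<le> mutual_info p u"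
proof -
  define enc :: "('x \<Rightarrow> 'y pmf) \<Rightarrow> real^('x \<times> 'y)" where "enc v = (\<chi> z. pmf (v (fst z)) (snd z))" for v
  define q where "q = pmf (bind_pmf p w)"
  define F :: "real^('x \<times> 'y) \<Rightarrow> real" where
    "F a = (\<Sum>(x,y)\<in>UNIV. pmf p x * (a $ (x,y) * log 2 (a $ (x,y) / q y)))" for a
  define A :: "(real^('x \<times> 'y)) set" where
    "A = {a. (\<forall>z. 0 \<le> a $ z) \<and> (\<forall>x. (\<Sum>y\<in>UNIV. a $ (x,y)) = 1)
           \<and> (\<forall>y. (\<Sum>x\<in>UNIV. pmf p x * a $ (x,y)) = q y)}"
  define B :: "(real^('x \<times> 'y)) set" where
    "B = (if \<exists>x y. k x y = 0 \<and> pmf p x * pmf (w x) y \<noteq> 0 then UNIV else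
       {a. (\<forall>x y. k x y = 0 \<longrightarrow> pmf p x * a $ (x,y) = 0) \<and>
         (\<Sum>(x,y)\<in>UNIV. pmf p x * a $ (x,y) * log 2 (k x y))
           \<ge> (\<Sum>(x,y)\<in>UNIV. pmf p x * pmf (w x) y * log 2 (k x y))})"
  have enc: "enc v \<in> A \<inter> B \<longleftrightarrow> v \<in> LM_constraint p w k" for v
  proof -
    have "enc v \<in> A \<longleftrightarrow> bind_pmf p v = bind_pmf p w"
      by (auto simp: A_def enc_def q_def sum_pmf_eq_1 pmf_output[symmetric] intro!: pmf_eqI)
    moreover have "enc v \<in> B \<longleftrightarrow> expected_log_metric (joint_pmf p v) k \<ge> expected_log_metric (joint_pmf p w) k"
      unfolding expected_log_metric_eq by (auto simp: B_def enc_def)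
    ultimately show ?thesis by (simp add: LM_constraint_def)
  qed
  have dec: "\<exists>v. a = enc v" if "a \<in> A" for a
  proof
    have "pmf (embed_pmf (\<lambda>y. a $ (x,y))) y = a $ (x,y)" for x y
    proof (rule pmf_embed_pmf)
      show "(\<integral>\<^sup>+ y. ennreal (a $ (x,y)) \<partial>count_space UNIV) = 1"
        using that by (simp add: nn_integral_count_space_finite A_def)
    qed (use that in \<open>simp add: A_def\<close>)
    then show "a = enc (\<lambda>x. embed_pmf (\<lambda>y. a $ (x,y)))"
      by (simp add: enc_def vec_eq_iff)
  qed
  have FI: "F (enc v) = mutual_info p v" if "v \<in> LM_constraint p w k" for v
    using that by (simp add: F_def enc_def q_def mutual_info_eq LM_constraint_def mult.assoc)
  have "closed A"
    unfolding A_def by (intro closed_Collect_conj closed_Collect_all closed_Collect_le closed_Collect_eq continuous_intros)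
  moreover have "closed B"
  proof -
    have "closed {a :: real^('x \<times> 'y). \<forall>x y. k x y = 0 \<longrightarrow> pmf p x * a $ (x,y) = 0}"
      by (intro closed_Collect_all closed_Collect_imp closed_Collect_eq continuous_intros) simp
    then show ?thesis
      unfolding B_def case_prod_beta
      by (auto simp del: mult_eq_0_iff intro!: closed_Collect_conj closed_Collect_le continuous_intros)
  qed
  moreover have "bounded A"
  proof (rule bounded_subset)
    show "bounded (cbox (0 :: real^('x \<times> 'y)) (\<chi> z. 1))" by simp
    show "A \<subseteq> cbox 0 (\<chi> z. 1)"
    proof
      fix a assume "a \<in> A"
      then obtain v where "a = enc v" using dec by blast
      then show "a \<in> cbox 0 (\<chi> z. 1)"
        by (auto simp: mem_box_cart enc_def pmf_le_1)
    qed
  qed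
  ultimately have "compact (A \<inter> B)"
    by (simp add: compact_eq_bounded_closed bounded_Int closed_Int)
  moreover have "w \<in> LM_constraint p w k" by (simp add: LM_constraint_def)
  then have "A \<inter> B \<noteq> {}" using enc by blast
  moreover have "continuous_on (A \<inter> B) F"
    unfolding F_def case_prod_beta
  proof (rule continuous_on_sum, rule continuous_on_mult_left)
    fix z :: "'x \<times> 'y"
    have "q (snd z) \<ge> 0" by (simp add: q_def)
    then have "continuous_on (A \<inter> B) (\<lambda>a. a $ z * log 2 (a $ z / q (snd z)))"
      by (rule continuous_on_compose2[OF continuous_on_mult_log2])
        (auto simp: A_def simp del: split_paired_All intro!: continuous_on_component continuous_on_id)
    then show "continuous_on (A \<inter> B) (\<lambda>a. a $ (fst z, snd z) * log 2 (a $ (fst z, snd z) / q (snd z)))"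
      by simp
  qed
  ultimately obtain a where a: "a \<in> A \<inter> B" "\<And>b. b \<in> A \<inter> B \<Longrightarrow> F a \<le> F b"
    using continuous_attains_inf by metis
  then obtain v where v: "a = enc v" using dec by blast
  have vc: "v \<in> LM_constraint p w k" using a v enc by blast
  have le: "mutual_info p v \<le> mutual_info p u" if "u \<in> LM_constraint p w k" for u
    using a(2)[of "enc u"] enc that FI vc v by metis
  have "LM_rate p w k = mutual_info p v"
    unfolding LM_rate_def using vc le by (intro cInf_eq_minimum) auto
  with vc le that show thesis by blast
qed

definition virtual_sample :: "real \<Rightarrow> ('x \<times> 'y) list \<Rightarrow> 'x \<Rightarrow> 'y \<Rightarrow> real" where
  "virtual_sample \<alpha> s = (\<lambda>x y. real (count_list s (x, y)) + real (length s) powr \<alpha>)"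

end

theory Submission
  imports Defs
begin

text \<open>
  Rescaling the metric to a distribution \<open>k / T\<close> on pairs, with \<open>T = \<Sum> k\<close>, Gibbs' inequality
  together with the constraint on the expected log metric shows that
  \<open>k \<ge> n (p \<times> w)\<close> pointwise already forces \<open>I(p,w) - I(p,v) \<le> log\<^sub>2 (T / n)\<close> for every
  admissible \<open>v\<close>. For the virtual sample metric \<open>T / n = 1 + |X| |Y| n\<^sup>\<alpha> / n\<close>, so the loss is
  below \<open>\<epsilon>\<close>. The pointwise bound fails at a given pair only if its count falls more than
  \<open>n\<^sup>\<alpha>\<close> short of its mean, which Hoeffding's inequality and a union bound control. The counts
  being integers, Hoeffding's bound is strict for the event of a strict deviation.
\<close>

section \<open>Mutual information and Gibbs' inequality\<close>

text \<open>The bound \<open>ln t \<le> t - 1\<close> at \<open>t = k z / (a z * T)\<close>,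
  weighted by \<open>a z\<close>, has right-hand sides \<open>k z / T - a z\<close>, which sum to 0.
  Leaving \<open>k\<close> unnormalised produces the term \<open>log 2 T\<close>. Where
  \<open>a z = 0\<close>, the left side vanishes and the right side is nonnegative.\<close>

lemma gibbs_ineq:
  fixes a k :: "'z::finite \<Rightarrow> real"
  assumes a: "\<And>z. a z \<ge> 0" "sum a UNIV = 1" and k: "\<And>z. k z > 0"
  shows "(\<Sum>z\<in>UNIV. a z * log 2 (k z)) \<le> (\<Sum>z\<in>UNIV. a z * log 2 (a z)) + log 2 (sum k UNIV)"
proof -
  define T where "T = sum k UNIV"
  have T: "T > 0"
    unfolding T_def using k by (intro sum_pos) auto
  have "a z * ln (k z) - a z * ln (a z) - a z * ln T \<le> k z / T - a z" for z
  proof (cases "a z = 0")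
    case True
    then show ?thesis using T k[of z] by simp
  next
    case False
    with a(1)[of z] have az: "a z > 0" by simp
    have "a z * ln (k z) - a z * ln (a z) - a z * ln T = a z * ln (k z / (a z * T))"
      using az T k[of z] by (simp add: ln_div ln_mult algebra_simps)
    also have "\<dots> \<le> a z * (k z / (a z * T) - 1)"
      using az T k[of z] by (intro mult_left_mono ln_le_minus_one) auto
    also have "\<dots> = k z / T - a z"
      using az T by (simp add: field_simps)
    finally show ?thesis .
  qed
  then have "(\<Sum>z\<in>UNIV. a z * ln (k z) - a z * ln (a z) - a z * ln T) \<le> (\<Sum>z\<in>UNIV. k z / T - a z)"
    by (intro sum_mono)
  also have "\<dots> = 0"
    using T by (simp add: sum_subtractf a(2) T_def flip: sum_divide_distrib)
  finally have "(\<Sum>z\<in>UNIV. a z * ln (k z)) \<le> (\<Sum>z\<in>UNIV. a z * ln (a z)) + ln T"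
    by (simp add: sum_subtractf a(2) flip: sum_distrib_right)
  then have "(\<Sum>z\<in>UNIV. a z * ln (k z)) / ln 2 \<le> ((\<Sum>z\<in>UNIV. a z * ln (a z)) + ln T) / ln 2"
    by (intro divide_right_mono) auto
  then show ?thesis
    by (simp add: log_def T_def sum_divide_distrib add_divide_distrib)
qed

text \<open>This is H(X) + H(Y) - H(X,Y). Once the input and output distributions are fixed, only
  the joint term depends on the channel.\<close>

lemma mutual_info_eq_entropies:
  fixes p :: "'x::finite pmf" and v :: "'x \<Rightarrow> 'y::finite pmf"
  shows "mutual_info p v =
    (\<Sum>z\<in>UNIV. pmf (joint_pmf p v) z * log 2 (pmf (joint_pmf p v) z))
    - (\<Sum>x\<in>UNIV. pmf p x * log 2 (pmf p x))
    - (\<Sum>y\<in>UNIV. pmf (bind_pmf p v) y * log 2 (pmf (bind_pmf p v) y))"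
proof -
  define q where "q = pmf (bind_pmf p v)"
  have "pmf p x * pmf (v x) y * log 2 (pmf (v x) y / q y) =
      pmf (joint_pmf p v) (x, y) * log 2 (pmf (joint_pmf p v) (x, y))
      - pmf p x * pmf (v x) y * log 2 (pmf p x) - pmf p x * pmf (v x) y * log 2 (q y)" for x y
  proof (cases "pmf p x * pmf (v x) y = 0")
    case False
    then have pv: "pmf p x > 0" "pmf (v x) y > 0"
      by (auto simp: less_le)
    \<comment> \<open>A joint probability is at most its marginal, so \<open>q y > 0\<close>
      wherever the weight is nonzero, and the logarithm of the quotient splits.\<close>
    have "pmf p x * pmf (v x) y \<le> q y"
      unfolding q_def pmf_output by (rule member_le_sum) auto
    with pv have "q y > 0"
      by (meson mult_pos_pos less_le_trans)
    with pv show ?thesis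
      by (simp add: pmf_joint_pmf log_divide_pos log_mult_pos algebra_simps)
  qed (auto simp: pmf_joint_pmf)
  then have "mutual_info p v =
      (\<Sum>(x,y)\<in>UNIV. pmf (joint_pmf p v) (x, y) * log 2 (pmf (joint_pmf p v) (x, y))
        - pmf p x * pmf (v x) y * log 2 (pmf p x) - pmf p x * pmf (v x) y * log 2 (q y))"
    by (simp add: mutual_info_eq q_def)
  also have "\<dots> = (\<Sum>z\<in>UNIV. pmf (joint_pmf p v) z * log 2 (pmf (joint_pmf p v) z))
      - (\<Sum>(x,y)\<in>UNIV. pmf p x * pmf (v x) y * log 2 (pmf p x))
      - (\<Sum>(x,y)\<in>UNIV. pmf p x * pmf (v x) y * log 2 (q y))"
    by (simp add: case_prod_beta sum_subtractf)
  also have "(\<Sum>(x,y)\<in>UNIV. pmf p x * pmf (v x) y * log 2 (pmf p x)) =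
      (\<Sum>x\<in>UNIV. \<Sum>y\<in>UNIV. pmf (v x) y * (pmf p x * log 2 (pmf p x)))"
    by (simp add: sum.cartesian_product mult_ac)
  also have "\<dots> = (\<Sum>x\<in>UNIV. pmf p x * log 2 (pmf p x))"
    by (simp add: sum_pmf_eq_1 flip: sum_distrib_right)
  also have "(\<Sum>(x,y)\<in>UNIV. pmf p x * pmf (v x) y * log 2 (q y)) =
      (\<Sum>x\<in>UNIV. \<Sum>y\<in>UNIV. pmf p x * pmf (v x) y * log 2 (q y))"
    by (simp add: sum.cartesian_product)
  also have "\<dots> = (\<Sum>y\<in>UNIV. \<Sum>x\<in>UNIV. pmf p x * pmf (v x) y * log 2 (q y))"
    by (rule sum.swap)
  also have "\<dots> = (\<Sum>y\<in>UNIV. q y * log 2 (q y))"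
    by (simp add: q_def pmf_output flip: sum_distrib_right)
  finally show ?thesis
    by (simp add: q_def)
qed

text \<open>Both joint distributions have the same marginals, so the difference is E_W log W - E_V
  log V. The pointwise bound gives E_W log W + log c \<le> E_W log k, the constraint passes to E_V
  log k, and Gibbs' inequality bounds this by E_V log V + log T.\<close>

lemma mutual_info_diff_le:
  fixes p :: "'x::finite pmf" and w v :: "'x \<Rightarrow> 'y::finite pmf"
  assumes v: "v \<in> LM_constraint p w k" and c: "c > 0"
    and k_pos: "\<And>x y. k x y > 0" and k_ge: "\<And>x y. k x y \<ge> c * pmf (joint_pmf p w) (x, y)"
  shows "mutual_info p w - mutual_info p v \<le> log 2 ((\<Sum>(x,y)\<in>UNIV. k x y) / c)"
proof -
  let ?V = "pmf (joint_pmf p v)" and ?W = "pmf (joint_pmf p w)"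
  let ?k = "case_prod k" and ?T = "\<Sum>(x,y)\<in>UNIV. k x y"
  have T: "?T > 0"
    using k_pos by (intro sum_pos) auto
  \<comment> \<open>Positivity excludes the value -\<infinity>, so the constraint compares two real
    sums.\<close>
  have nz: "k x y \<noteq> 0" for x y
    using k_pos[of x y] by simp
  have "ereal (\<Sum>z\<in>UNIV. ?W z * log 2 (?k z)) \<le> ereal (\<Sum>z\<in>UNIV. ?V z * log 2 (?k z))"
    using v unfolding LM_constraint_def expected_log_metric_eq
    by (simp add: nz case_prod_beta flip: pmf_joint_pmf)
  then have W_le_V: "(\<Sum>z\<in>UNIV. ?W z * log 2 (?k z)) \<le> (\<Sum>z\<in>UNIV. ?V z * log 2 (?k z))"
    by simp
  have V_le: "(\<Sum>z\<in>UNIV. ?V z * log 2 (?k z)) \<le> (\<Sum>z\<in>UNIV. ?V z * log 2 (?V z)) + log 2 ?T"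
    by (rule gibbs_ineq) (auto simp: sum_pmf_eq_1 k_pos)
  have "?W z * log 2 (?W z) + ?W z * log 2 c \<le> ?W z * log 2 (?k z)" for z
  proof (cases "?W z = 0")
    case False
    then have "?W z > 0"
      by (simp add: less_le)
    moreover have "c * ?W z \<le> ?k z"
      using k_ge by (cases z) auto
    ultimately have "log 2 (c * ?W z) \<le> log 2 (?k z)"
      using c by (intro log_mono) auto
    then have "?W z * log 2 (c * ?W z) \<le> ?W z * log 2 (?k z)"
      by (intro mult_left_mono) auto
    then show ?thesis
      using c \<open>?W z > 0\<close> by (simp add: log_mult_pos algebra_simps)
  qed simp
  then have "(\<Sum>z\<in>UNIV. ?W z * log 2 (?W z) + ?W z * log 2 c) \<le> (\<Sum>z\<in>UNIV. ?W z * log 2 (?k z))"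
    by (intro sum_mono)
  then have "(\<Sum>z\<in>UNIV. ?W z * log 2 (?W z)) + log 2 c \<le> (\<Sum>z\<in>UNIV. ?W z * log 2 (?k z))"
    by (simp add: sum.distrib sum_pmf_eq_1 flip: sum_distrib_right)
  moreover have "bind_pmf p v = bind_pmf p w"
    using v by (simp add: LM_constraint_def)
  ultimately show ?thesis
    using W_le_V V_le T c by (simp add: mutual_info_eq_entropies log_divide_pos)
qed

section \<open>Concentration of the counts\<close>

lemma count_list_map_upt:
  "real (count_list (map f [0..<n]) z) = (\<Sum>i<n. indicator {z} (f i))"
  by (induction n) auto

lemma (in prob_space) count_lower_tail:
  assumes indep: "indep_vars (\<lambda>_. count_space UNIV) S {..<n}" and n: "n > 0" and t: "t \<ge> 0"
    and q: "\<And>i. i < n \<Longrightarrow> prob {\<omega> \<in> space M. S i \<omega> = z} = q"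
  shows "prob {\<omega> \<in> space M. real (count_list (map (\<lambda>i. S i \<omega>) [0..<n]) z) < n * q - t}
    < exp (-2 * t\<^sup>2 / n)"
proof -
  let ?X = "\<lambda>i \<omega>. indicator {z} (S i \<omega>) :: real"
  have S: "S i \<in> M \<rightarrow>\<^sub>M count_space UNIV" if "i < n" for i
    using indep that by (simp add: indep_vars_def)
  have expect: "expectation (?X i) = q" if "i < n" for i
  proof -
    have "expectation (?X i) = expectation (indicator {\<omega> \<in> space M. S i \<omega> = z})"
      by (intro Bochner_Integration.integral_cong) (auto simp: indicator_def)
    with q[OF that] show ?thesis by (simp add: Int_def conj_commute)
  qed
  \<comment> \<open>The count is a sum of \<open>n\<close> independent variables in [0,1] with total
    mean \<open>n * q\<close>; the squared ranges add up to \<open>n\<close>.\<close>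
  interpret Hoeffding_ineq M "{..<n}" ?X "\<lambda>_. 0" "\<lambda>_. 1" "n * q"
  proof unfold_locales
    show "indep_vars (\<lambda>_. borel) ?X {..<n}"
      by (rule indep_vars_compose2[OF indep]) auto
  qed (simp_all add: expect)
  \<comment> \<open>\<open>b\<close> is the largest integer strictly below \<open>n * q - t\<close>.
    A count below \<open>n * q - t\<close> is at most \<open>b\<close>, hence short of the mean by
    at least \<open>t' > t\<close>, and the exponential bound at \<open>t'\<close> is strictly
    smaller.\<close>
  define b where "b = real_of_int (\<lceil>n * q - t\<rceil> - 1)"
  define t' where "t' = n * q - b"
  have tt': "t < t'"
    unfolding t'_def b_def using ceiling_correct[of "n * q - t"] by simp
  have "prob {\<omega> \<in> space M. real (count_list (map (\<lambda>i. S i \<omega>) [0..<n]) z) < n * q - t}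
      \<le> prob {\<omega> \<in> space M. (\<Sum>i<n. ?X i \<omega>) \<le> n * q - t'}"
  proof (rule finite_measure_mono)
    have "real j \<le> b" if "real j < n * q - t" for j
    proof -
      have "int j \<le> \<lceil>n * q - t\<rceil> - 1"
        using that by (simp add: less_ceiling_iff)
      then show ?thesis
        unfolding b_def by linarith
    qed
    then show "{\<omega> \<in> space M. real (count_list (map (\<lambda>i. S i \<omega>) [0..<n]) z) < n * q - t}
        \<subseteq> {\<omega> \<in> space M. (\<Sum>i<n. ?X i \<omega>) \<le> n * q - t'}"
      by (auto simp: t'_def simp flip: count_list_map_upt)
  qed measurable
  also have "\<dots> \<le> exp (-2 * t'\<^sup>2 / n)"
    using Hoeffding_ineq_le[of t'] tt' t n by simp
  also have "\<dots> < exp (-2 * t\<^sup>2 / n)"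
    using tt' t n by (simp add: divide_strict_right_mono power_strict_mono)
  finally show ?thesis .
qed

text \<open>The head takes countably many values, so it can be fixed in the inductive step. As the
  target is discrete, every condition on the training set, including one on \<open>LM_rate\<close>,
  then defines an event.\<close>

lemma measurable_map_list:
  fixes S :: "'i \<Rightarrow> 'a \<Rightarrow> 'b::countable"
  assumes "\<And>i. i \<in> set xs \<Longrightarrow> S i \<in> M \<rightarrow>\<^sub>M count_space UNIV"
  shows "(\<lambda>\<omega>. map (\<lambda>i. S i \<omega>) xs) \<in> M \<rightarrow>\<^sub>M count_space UNIV"
  using assms
proof (induction xs)
  case (Cons i xs)
  have "(\<lambda>\<omega>. a # map (\<lambda>i. S i \<omega>) xs) \<in> M \<rightarrow>\<^sub>M count_space UNIV" for a
    using Cons by (intro measurable_compose[OF _ measurable_count_space]) auto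
  from measurable_compose_countable[OF this, of "S i"] Cons.prems show ?case
    by simp
qed simp

section \<open>The virtual sample metric\<close>

lemma sum_virtual_sample:
  fixes s :: "('x::finite \<times> 'y::finite) list"
  shows "(\<Sum>(x,y)\<in>UNIV. virtual_sample \<alpha> s x y) =
    length s + CARD('x) * CARD('y) * real (length s) powr \<alpha>"
proof -
  have "(\<Sum>z\<in>UNIV. real (count_list s z)) = length s"
    using sum_count_set[of s UNIV] by (simp flip: of_nat_sum)
  then show ?thesis
    by (simp add: virtual_sample_def case_prod_beta sum.distrib)
qed

text \<open>The deterministic half: the \<open>n powr \<alpha>\<close> virtual samples per pair make
  up for the allowed shortfall of the counts, so \<open>mutual_info_diff_le\<close> applies with
  \<open>c = n\<close>.\<close>

lemma LM_rate_virtual_sample_gt: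
  fixes p :: "'x::finite pmf" and w :: "'x \<Rightarrow> 'y::finite pmf" and s :: "('x \<times> 'y) list"
  assumes n: "length s = n" "n > 0" and \<epsilon>: "CARD('x) * CARD('y) * real n powr \<alpha> / n \<le> \<epsilon> * ln 2"
    and count: "\<And>z. real (count_list s z) \<ge> n * pmf (joint_pmf p w) z - real n powr \<alpha>"
  shows "mutual_info p w - \<epsilon> < LM_rate p w (virtual_sample \<alpha> s)"
proof -
  let ?k = "virtual_sample \<alpha> s" and ?u = "CARD('x) * CARD('y) * real n powr \<alpha> / n"
  obtain v where v: "v \<in> LM_constraint p w ?k" and LM: "LM_rate p w ?k = mutual_info p v"
    by (rule LM_rate_attained)
  have u: "?u > 0"
    using n by simp
  have "mutual_info p w - mutual_info p v \<le> log 2 ((\<Sum>(x,y)\<in>UNIV. ?k x y) / n)"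
  proof (rule mutual_info_diff_le[OF v])
    show "?k x y > 0" for x y
      using n by (simp add: virtual_sample_def add_nonneg_pos)
    show "real n * pmf (joint_pmf p w) (x, y) \<le> ?k x y" for x y
      using count[of "(x, y)"] n by (simp add: virtual_sample_def)
  qed (use n in simp)
  also have "\<dots> = ln (1 + ?u) / ln 2"
    unfolding sum_virtual_sample using n by (simp add: log_def add_divide_distrib)
  \<comment> \<open>The strictness of the conclusion comes from here: \<open>ln (1 + u) < u\<close>
    for \<open>u > 0\<close>.\<close>
  also have "\<dots> < ?u / ln 2"
    using ln_add_one_self_less_self[OF u] by (intro divide_strict_right_mono) auto
  also have "\<dots> \<le> \<epsilon>"
    using \<epsilon> by (subst pos_divide_le_eq) auto
  finally show ?thesis
    using LM by simp
qed

lemma powr_ge_of_ge_powr_inverse: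
  fixes x y r :: real
  assumes "y \<ge> 0" "r > 0" "x \<ge> y powr (1 / r)"
  shows "x powr r \<ge> y"
proof -
  have "(y powr (1 / r)) powr r \<le> x powr r"
    using assms by (intro powr_mono2) auto
  then show ?thesis
    using assms by (simp add: powr_powr)
qed

theorem theorem2:
  fixes p :: "'x::finite pmf" and w :: "'x \<Rightarrow> 'y::finite pmf"
    and \<alpha> \<epsilon> \<delta> :: real and n :: nat
    and M :: "'a measure" and S :: "nat \<Rightarrow> 'a \<Rightarrow> 'x \<times> 'y"
    and K :: "'a \<Rightarrow> 'x \<Rightarrow> 'y \<Rightarrow> real"
  assumes "1 / 2 < \<alpha>" and "\<alpha> < 1" and "\<epsilon> > 0" and "0 < \<delta>" and "\<delta> < 1" and "n > 0"
    and "real n \<ge> (real CARD('x) * real CARD('y) / (\<epsilon> * ln 2)) powr (1 / (1 - \<alpha>))"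
    and "real n \<ge> (1 / 2 * ln (real CARD('x) * real CARD('y) / \<delta>)) powr (1 / (2 * \<alpha> - 1))"
    and "prob_space M"
    and "prob_space.indep_vars M (\<lambda>_. count_space UNIV) S {..<n}"
    and "\<And>i. i < n \<Longrightarrow> distr M (count_space UNIV) (S i) = measure_pmf (joint_pmf p w)"
    and "\<And>\<omega>. \<omega> \<in> space M \<Longrightarrow> K \<omega> = virtual_sample \<alpha> (map (\<lambda>i. S i \<omega>) [0..<n])"
  shows "measure M {\<omega> \<in> space M. mutual_info p w - \<epsilon> < LM_rate p w (K \<omega>)} > 1 - \<delta>"
proof -
  note n = \<open>n > 0\<close> and indep = assms(10) and distr = assms(11) and K = assms(12)
  interpret prob_space M by fact
  define m where "m = real CARD('x) * real CARD('y)"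
  have m: "m \<ge> 1"
    unfolding m_def using mult_mono[of 1 "real CARD('x)" 1 "real CARD('y)"] by (simp add: Suc_leI)
  let ?J = "pmf (joint_pmf p w)" and ?s = "\<lambda>\<omega>. map (\<lambda>i. S i \<omega>) [0..<n]"
  \<comment> \<open>\<open>B z\<close> is the bad event for the pair \<open>z\<close>; the tolerated
    deviation is the number of virtual samples.\<close>
  define B where "B z = {\<omega> \<in> space M. real (count_list (?s \<omega>) z) < n * ?J z - real n powr \<alpha>}" for z
  define G where "G = {\<omega> \<in> space M. mutual_info p w - \<epsilon> < LM_rate p w (K \<omega>)}"

  have S: "S i \<in> M \<rightarrow>\<^sub>M count_space UNIV" if "i < n" for i
    using indep that by (simp add: indep_vars_def)
  have s [measurable]: "?s \<in> M \<rightarrow>\<^sub>M count_space UNIV"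
    using S by (intro measurable_map_list) auto
  have B_meas: "B z \<in> events" for z
    unfolding B_def by measurable
  have "G = {\<omega> \<in> space M. mutual_info p w - \<epsilon> < LM_rate p w (virtual_sample \<alpha> (?s \<omega>))}"
    using K by (auto simp: G_def)
  also have "\<dots> \<in> events"
    by measurable
  finally have G_meas: "G \<in> events" .

  have "m / (\<epsilon> * ln 2) \<le> real n powr (1 - \<alpha>)"
    using assms(2,3,7) m by (intro powr_ge_of_ge_powr_inverse) (auto simp: m_def)
  then have "m \<le> \<epsilon> * ln 2 * real n powr (1 - \<alpha>)"
    using assms(3) by (simp add: field_simps)
  also have "\<dots> = \<epsilon> * ln 2 * (n / real n powr \<alpha>)"
    using n by (simp add: powr_diff)
  finally have \<epsilon>: "m * real n powr \<alpha> / n \<le> \<epsilon> * ln 2"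
    using n by (simp add: field_simps)

  \<comment> \<open>Since \<open>m \<ge> 1\<close> and \<open>\<delta> < 1\<close>, the logarithm is
    nonnegative, as inverting the power requires. The exponent \<open>2 * \<alpha> - 1\<close> is
    the one that Hoeffding's bound yields for the deviation \<open>n powr \<alpha>\<close>.\<close>
  have "1 / 2 * ln (m / \<delta>) \<le> real n powr (2 * \<alpha> - 1)"
    using assms(1,4,5,8) m by (intro powr_ge_of_ge_powr_inverse) (auto simp: m_def)
  also have "\<dots> = (real n powr \<alpha>)\<^sup>2 / n"
    using n by (simp add: powr_diff powr_powr mult.commute flip: powr_numeral)
  finally have "- 2 * (real n powr \<alpha>)\<^sup>2 / n \<le> ln (\<delta> / m)"
    using m assms(4) by (simp add: ln_div field_simps)
  then have exp_le: "exp (- 2 * (real n powr \<alpha>)\<^sup>2 / n) \<le> \<delta> / m"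
    using m assms(4) by (subst (asm) ln_ge_iff) auto

  have B_prob: "prob (B z) < \<delta> / m" for z
  proof -
    have "prob {\<omega> \<in> space M. S i \<omega> = z} = ?J z" if "i < n" for i
    proof -
      have "prob {\<omega> \<in> space M. S i \<omega> = z} = measure (distr M (count_space UNIV) (S i)) {z}"
        using S[OF that] by (subst measure_distr) (auto intro!: arg_cong[where f = prob])
      then show ?thesis
        using distr[OF that] by (simp add: measure_pmf_single)
    qed
    then have "prob (B z) < exp (- 2 * (real n powr \<alpha>)\<^sup>2 / n)"
      unfolding B_def using n by (intro count_lower_tail[OF indep]) auto
    with exp_le show ?thesis by simp
  qed

  have "space M - G \<subseteq> (\<Union>z. B z)"
  proof
    fix \<omega> assume \<omega>: "\<omega> \<in> space M - G"
    show "\<omega> \<in> (\<Union>z. B z)"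
    proof (rule ccontr)
      assume "\<omega> \<notin> (\<Union>z. B z)"
      then have "real (count_list (?s \<omega>) z) \<ge> n * ?J z - real n powr \<alpha>" for z
        using \<omega> by (cases z) (auto simp: B_def not_less)
      then have "mutual_info p w - \<epsilon> < LM_rate p w (virtual_sample \<alpha> (?s \<omega>))"
        using n \<epsilon> by (intro LM_rate_virtual_sample_gt[where n = n]) (auto simp: m_def)
      with \<omega> K show False by (auto simp: G_def)
    qed
  qed
  then have "prob (space M - G) \<le> prob (\<Union>z. B z)"
    using B_meas by (intro finite_measure_mono) auto
  also have "\<dots> \<le> (\<Sum>z\<in>UNIV. prob (B z))"
    using B_meas by (intro measure_UNION_le) auto
  \<comment> \<open>The union bound has \<open>m\<close> terms, each strictly below
    \<open>\<delta> / m\<close>; there is at least one, so strictness survives summation.\<close>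
  also have "\<dots> < (\<Sum>z\<in>(UNIV :: ('x \<times> 'y) set). \<delta> / m)"
    using B_prob by (intro sum_strict_mono) auto
  also have "\<dots> = \<delta>"
    using m by (simp add: m_def)
  finally show ?thesis
    using prob_compl[OF G_meas] by (simp add: G_def)
qed

end
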